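(* If the mechanical system with data $(a_i)$, $(b_j)$, $(c_{ij})$ described in the context is in equilibrium, and if $F_{ij}$ is the force transmitted through stud $c_{ij}$ from row $A_i$ to column $B_j$, then $f_{ij}=F_{ij}$ is an optimal solution of the transportation problem with data $(a_i)$, $(b_j)$, $(c_{ij})$.
   Context: Data: integers $m,n\ge 1$, real numbers $a_i\ge 0$ ($1\le i\le m$), $b_j\ge 0$ ($1\le j\le n$) with $\sum_{i=1}^m a_i=\sum_{j=1}^n b_j$, and an arbitrary real matrix $(c_{ij})$. Transportation problem: maximize $\sum_i\sum_j c_{ij}f_{ij}$ subject to $\sum_j f_{ij}=a_i$ for all $i$, $\sum_i f_{ij}=b_j$ for all $j$, and $f_{ij}\ge 0$ for all $i,j$. A matrix $(f_{ij})$ satisfying these constraints is a feasible solution; a feasible solution which maximizes $\sum_i\sum_j c_{ij}f_{ij}$ among feasible solutions is an optimal solution. Mechanical system: row $A_i$ is a rod at variable height $\alpha_i\in\mathbb R$ subjected to a downward force (weight) $a_i$; column $B_j$ is a rod at variable height $\beta_j\in\mathbb R$ subjected to an upward force (buoyancy) $b_j$. Rods move only vertically. For each pair $(i,j)$ a weightless stud enforces $\alpha_i-\beta_j\ge c_{ij}$, and $A_i$ and $B_j$ are in contact (through this stud) exactly when $\alpha_i-\beta_j=c_{ij}$. The force $F_{ij}$ transmitted from $A_i$ to $B_j$ through the stud is a contact force: $F_{ij}\ge 0$, and $F_{ij}=0$ unless $A_i$ and $B_j$ are in contact. The only forces acting are the weights, the buoyancies and the contact forces. The system is in equilibrium when the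 forces on every rod balance: for each row $A_i$ the total force transmitted by it to the columns equals $a_i$, i.e. $\sum_j F_{ij}=a_i$, and for each column $B_j$ the total force received by it equals $b_j$, i.e. $\sum_i F_{ij}=b_j$. *)

theory Defs
  imports Complex_Main
begin

text \<open>
  Rows are indexed by \<open>{1..m}\<close> and columns by \<open>{1..n}\<close>.  Vectors and matrices are total
  functions on \<open>nat\<close>; only their values on these index ranges are ever constrained or used.
\<close>

definition transportation_data ::
  "nat \<Rightarrow> nat \<Rightarrow> (nat \<Rightarrow> real) \<Rightarrow> (nat \<Rightarrow> real) \<Rightarrow> bool" where
  "transportation_data m n a b \<longleftrightarrow>
     1 \<le> m \<and> 1 \<le> n \<and>
     (\<forall>i\<in>{1..m}. 0 \<le> a i) \<and> (\<forall>j\<in>{1..n}. 0 \<le> b j) \<and>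
     (\<Sum>i=1..m. a i) = (\<Sum>j=1..n. b j)"

definition transport_value ::
  "nat \<Rightarrow> nat \<Rightarrow> (nat \<Rightarrow> nat \<Rightarrow> real) \<Rightarrow> (nat \<Rightarrow> nat \<Rightarrow> real) \<Rightarrow> real" where
  "transport_value m n c f = (\<Sum>i=1..m. \<Sum>j=1..n. c i j * f i j)"

definition feasible_solution ::
  "nat \<Rightarrow> nat \<Rightarrow> (nat \<Rightarrow> real) \<Rightarrow> (nat \<Rightarrow> real) \<Rightarrow> (nat \<Rightarrow> nat \<Rightarrow> real) \<Rightarrow> bool" where
  "feasible_solution m n a b f \<longleftrightarrow>
     (\<forall>i\<in>{1..m}. (\<Sum>j=1..n. f i j) = a i) \<and>
     (\<forall>j\<in>{1..n}. (\<Sum>i=1..m. f i j) = b j) \<and>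
     (\<forall>i\<in>{1..m}. \<forall>j\<in>{1..n}. 0 \<le> f i j)"

definition optimal_solution ::
  "nat \<Rightarrow> nat \<Rightarrow> (nat \<Rightarrow> real) \<Rightarrow> (nat \<Rightarrow> real) \<Rightarrow> (nat \<Rightarrow> nat \<Rightarrow> real)
    \<Rightarrow> (nat \<Rightarrow> nat \<Rightarrow> real) \<Rightarrow> bool" where
  "optimal_solution m n a b c f \<longleftrightarrow>
     feasible_solution m n a b f \<and>
     (\<forall>g. feasible_solution m n a b g \<longrightarrow> transport_value m n c g \<le> transport_value m n c f)"

text \<open>
  A configuration of the mechanical system is given by the heights \<open>\<alpha> i\<close> of the row rods and
  \<open>\<beta> j\<close> of the column rods; the stud for \<open>(i, j)\<close> keeps the two rods at least \<open>c i j\<close> apart.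
\<close>

definition admissible_heights ::
  "nat \<Rightarrow> nat \<Rightarrow> (nat \<Rightarrow> nat \<Rightarrow> real) \<Rightarrow> (nat \<Rightarrow> real) \<Rightarrow> (nat \<Rightarrow> real) \<Rightarrow> bool" where
  "admissible_heights m n c \<alpha> \<beta> \<longleftrightarrow> (\<forall>i\<in>{1..m}. \<forall>j\<in>{1..n}. \<alpha> i - \<beta> j \<ge> c i j)"

definition in_contact ::
  "(nat \<Rightarrow> nat \<Rightarrow> real) \<Rightarrow> (nat \<Rightarrow> real) \<Rightarrow> (nat \<Rightarrow> real) \<Rightarrow> nat \<Rightarrow> nat \<Rightarrow> bool" where
  "in_contact c \<alpha> \<beta> i j \<longleftrightarrow> \<alpha> i - \<beta> j = c i j"

definition contact_forces ::
  "nat \<Rightarrow> nat \<Rightarrow> (nat \<Rightarrow> nat \<Rightarrow> real) \<Rightarrow> (nat \<Rightarrow> real) \<Rightarrow> (nat \<Rightarrow> real)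
    \<Rightarrow> (nat \<Rightarrow> nat \<Rightarrow> real) \<Rightarrow> bool" where
  "contact_forces m n c \<alpha> \<beta> F \<longleftrightarrow>
     (\<forall>i\<in>{1..m}. \<forall>j\<in>{1..n}. 0 \<le> F i j \<and> (\<not> in_contact c \<alpha> \<beta> i j \<longrightarrow> F i j = 0))"

definition forces_balance ::
  "nat \<Rightarrow> nat \<Rightarrow> (nat \<Rightarrow> real) \<Rightarrow> (nat \<Rightarrow> real) \<Rightarrow> (nat \<Rightarrow> nat \<Rightarrow> real) \<Rightarrow> bool" where
  "forces_balance m n a b F \<longleftrightarrow>
     (\<forall>i\<in>{1..m}. (\<Sum>j=1..n. F i j) = a i) \<and>
     (\<forall>j\<in>{1..n}. (\<Sum>i=1..m. F i j) = b j)"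

text \<open>
  The system is in equilibrium at heights \<open>\<alpha>\<close>, \<open>\<beta>\<close>, where \<open>F i j\<close> is the force that row \<open>i\<close>
  transmits to column \<open>j\<close> through their stud.
\<close>

definition in_equilibrium ::
  "nat \<Rightarrow> nat \<Rightarrow> (nat \<Rightarrow> real) \<Rightarrow> (nat \<Rightarrow> real) \<Rightarrow> (nat \<Rightarrow> nat \<Rightarrow> real)
    \<Rightarrow> (nat \<Rightarrow> real) \<Rightarrow> (nat \<Rightarrow> real) \<Rightarrow> (nat \<Rightarrow> nat \<Rightarrow> real) \<Rightarrow> bool" where
  "in_equilibrium m n a b c \<alpha> \<beta> F \<longleftrightarrow>
     admissible_heights m n c \<alpha> \<beta> \<and>
     contact_forces m n c \<alpha> \<beta> F \<and>
     forces_balance m n a b F"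

end

theory Submission
  imports Defs
begin

text \<open>
  The argument is linear programming duality, with the rod heights as dual variables. For
  any matrix whose row and column sums are \<open>a\<close> and \<open>b\<close>, the total of \<open>(\<alpha> i - \<beta> j) * f i j\<close>
  depends only on the marginals: it is the potential energy
  \<open>(\<Sum>i. \<alpha> i * a i) - (\<Sum>j. \<beta> j * b j)\<close> of the weights and buoyancies
  (\<open>sum_height_gaps_eq_potential_energy\<close>). The studs force \<open>c i j \<le> \<alpha> i - \<beta> j\<close>, so this energy
  is an upper bound for the value of every feasible solution
  (\<open>transport_value_le_potential_energy\<close>). The equilibrium forces attain the bound, because a
  force is transmitted only where the stud constraint is tight
  (\<open>transport_value_contact_forces\<close>).
\<close>

definition potential_energy ::
  "nat \<Rightarrow> nat \<Rightarrow> (nat \<Rightarrow> real) \<Rightarrow> (nat \<Rightarrow> real) \<Rightarrow> (nat \<Rightarrow> real) \<Rightarrow> (nat \<Rightarrow> real) \<Rightarrow> real" where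
  "potential_energy m n a b \<alpha> \<beta> = (\<Sum>i=1..m. \<alpha> i * a i) - (\<Sum>j=1..n. \<beta> j * b j)"

lemma feasible_solution_iff:
  "feasible_solution m n a b f \<longleftrightarrow>
     forces_balance m n a b f \<and> (\<forall>i\<in>{1..m}. \<forall>j\<in>{1..n}. 0 \<le> f i j)"
  unfolding feasible_solution_def forces_balance_def by blast

text \<open>
  Summing the \<open>\<alpha>\<close> part along rows and the \<open>\<beta>\<close> part along columns turns \<open>f\<close> into its marginals,
  so two matrices that balance the same loads cannot be told apart by this sum.
\<close>

lemma sum_height_gaps_eq_potential_energy:
  assumes "forces_balance m n a b f"
  shows "(\<Sum>i=1..m. \<Sum>j=1..n. (\<alpha> i - \<beta> j) * f i j) = potential_energy m n a b \<alpha> \<beta>"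
proof -
  have rows: "(\<Sum>i=1..m. \<Sum>j=1..n. \<alpha> i * f i j) = (\<Sum>i=1..m. \<alpha> i * a i)"
    using assms unfolding forces_balance_def
    by (intro sum.cong) (simp_all flip: sum_distrib_left)
  have "(\<Sum>i=1..m. \<Sum>j=1..n. \<beta> j * f i j) = (\<Sum>j=1..n. \<Sum>i=1..m. \<beta> j * f i j)"
    by (rule sum.swap)
  also have "\<dots> = (\<Sum>j=1..n. \<beta> j * b j)"
    using assms unfolding forces_balance_def
    by (intro sum.cong) (simp_all flip: sum_distrib_left)
  finally show ?thesis
    using rows by (simp add: potential_energy_def left_diff_distrib sum_subtractf)
qed

text \<open>
  Weak duality: nonnegative weights \<open>f i j\<close> preserve the stud inequalities \<open>c i j \<le> \<alpha> i - \<beta> j\<close>.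
\<close>

lemma transport_value_le_potential_energy:
  assumes "admissible_heights m n c \<alpha> \<beta>" and "feasible_solution m n a b f"
  shows "transport_value m n c f \<le> potential_energy m n a b \<alpha> \<beta>"
proof -
  have "transport_value m n c f \<le> (\<Sum>i=1..m. \<Sum>j=1..n. (\<alpha> i - \<beta> j) * f i j)"
    using assms unfolding transport_value_def admissible_heights_def feasible_solution_def
    by (intro sum_mono mult_right_mono) auto
  also have "\<dots> = potential_energy m n a b \<alpha> \<beta>"
    using assms(2) unfolding feasible_solution_iff
    by (intro sum_height_gaps_eq_potential_energy) (rule conjunct1)
  finally show ?thesis .
qed

text \<open>
  Complementary slackness: in each term either the rods touch and \<open>c i j\<close> is the height gap, or
  the force vanishes.
\<close>

lemma transport_value_contact_forces:
  assumes "contact_forces m n c \<alpha> \<beta> F" and "forces_balance m n a b F"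
  shows "transport_value m n c F = potential_energy m n a b \<alpha> \<beta>"
proof -
  have "c i j * F i j = (\<alpha> i - \<beta> j) * F i j" if "i \<in> {1..m}" "j \<in> {1..n}" for i j
    using assms(1) that unfolding contact_forces_def in_contact_def
    by (cases "\<alpha> i - \<beta> j = c i j") auto
  then have "transport_value m n c F = (\<Sum>i=1..m. \<Sum>j=1..n. (\<alpha> i - \<beta> j) * F i j)"
    unfolding transport_value_def by (intro sum.cong refl) auto
  also have "\<dots> = potential_energy m n a b \<alpha> \<beta>"
    by (rule sum_height_gaps_eq_potential_energy[OF assms(2)])
  finally show ?thesis .
qed

theorem theorem2:
  fixes m n :: nat
    and a b :: "nat \<Rightarrow> real"
    and c :: "nat \<Rightarrow> nat \<Rightarrow> real"
    and \<alpha> \<beta> :: "nat \<Rightarrow> real"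
    and F :: "nat \<Rightarrow> nat \<Rightarrow> real"
  assumes "transportation_data m n a b"
    and "in_equilibrium m n a b c \<alpha> \<beta> F"
  shows "optimal_solution m n a b c F"
proof -
  have heights: "admissible_heights m n c \<alpha> \<beta>"
    and contact: "contact_forces m n c \<alpha> \<beta> F"
    and balance: "forces_balance m n a b F"
    using assms(2) unfolding in_equilibrium_def by auto
  have "feasible_solution m n a b F"
    using contact balance unfolding feasible_solution_iff contact_forces_def by blast
  moreover have "transport_value m n c g \<le> transport_value m n c F"
    if "feasible_solution m n a b g" for g
    using transport_value_le_potential_energy[OF heights that]
      transport_value_contact_forces[OF contact balance] by simp
  ultimately show ?thesis
    unfolding optimal_solution_def by blast
qed

end
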